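(* Let $\lambda>1$ and $0<k<\lambda$. If $s\in\Gamma_1$ and $u\in\Gamma_2$, then the system $$ks\,u''+\lambda s\,\eta''+u-\lambda\eta+\eta u=0,\qquad \Big[\tfrac13-(2k+1)s\Big]\lambda u''+ks\,\eta''-\lambda u+\eta+\tfrac12u^2=0\qquad\text{on }\mathbb R$$ does not admit any monotone front solution $(u,\eta,s)$.
   Context: Here $$\Gamma_1=\Big\{s\in(0,\infty):\ \tfrac{\lambda^2}{3}-\big[(2k+1)\lambda^2+k^2\big]s>0\Big\},\qquad \Gamma_2=\{u:\ \|u\|_{C^0(\mathbb R)}<\lambda\}.$$ For $s\in\Gamma_1$ and $u\in\Gamma_2$, $(u,\eta,s)$ is called a monotone front solution of the system if $u,\eta\in C^2(\mathbb R)$ have bounded $C^2(\mathbb R)$ norms, $(u,\eta)$ solves the system on $\mathbb R$, and $$\lim_{x\to+\infty}(u(x),\eta(x))=(0,0),\qquad u>0,\quad\eta>0,\quad u'\le0,\quad\eta'\le0\quad\text{in }\mathbb R.$$ *)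

theory Defs
  imports "HOL-Analysis.Analysis"
begin

definition Gamma1 :: "real \<Rightarrow> real \<Rightarrow> real set" where
  "Gamma1 lam k = {s. 0 < s \<and> lam\<^sup>2 / 3 - ((2 * k + 1) * lam\<^sup>2 + k\<^sup>2) * s > 0}"

text \<open>The \<open>C\<^sup>0\<close> norm on the real line is the library's supremum norm on bounded continuous functions.
  The abstraction \<open>Bcontfun\<close> is meaningful only on \<open>bcontfun\<close>, hence the membership condition.\<close>

definition Gamma2 :: "real \<Rightarrow> (real \<Rightarrow> real) set" where
  "Gamma2 lam = {u. u \<in> bcontfun \<and> norm (Bcontfun u) < lam}"

text \<open>Twice continuously differentiable functions on the real line with finite \<open>C\<^sup>2\<close> norm, that is,
  the function and its first two derivatives are continuous and bounded. As \<open>deriv\<close> is total,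
  differentiability is required separately.\<close>

definition C2_bounded :: "(real \<Rightarrow> real) set" where
  "C2_bounded = {f. (\<forall>x. f field_differentiable at x) \<and> (\<forall>x. deriv f field_differentiable at x) \<and>
     f \<in> bcontfun \<and> deriv f \<in> bcontfun \<and> deriv (deriv f) \<in> bcontfun}"

definition solves_system ::
    "real \<Rightarrow> real \<Rightarrow> real \<Rightarrow> (real \<Rightarrow> real) \<Rightarrow> (real \<Rightarrow> real) \<Rightarrow> bool" where
  "solves_system lam k s u eta \<longleftrightarrow> (\<forall>x.
     k * s * deriv (deriv u) x + lam * s * deriv (deriv eta) x
       + u x - lam * eta x + eta x * u x = 0 \<and>
     (1/3 - (2 * k + 1) * s) * lam * deriv (deriv u) x + k * s * deriv (deriv eta) x
       - lam * u x + eta x + 1/2 * (u x)\<^sup>2 = 0)"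

text \<open>The notion is intended for \<open>s \<in> Gamma1 lam k\<close> and \<open>u \<in> Gamma2 lam\<close>.\<close>

definition monotone_front_solution ::
    "real \<Rightarrow> real \<Rightarrow> (real \<Rightarrow> real) \<Rightarrow> (real \<Rightarrow> real) \<Rightarrow> real \<Rightarrow> bool" where
  "monotone_front_solution lam k u eta s \<longleftrightarrow>
     u \<in> C2_bounded \<and> eta \<in> C2_bounded \<and> solves_system lam k s u eta \<and>
     ((\<lambda>x. (u x, eta x)) \<longlongrightarrow> (0, 0)) at_top \<and>
     (\<forall>x. u x > 0 \<and> eta x > 0 \<and> deriv u x \<le> 0 \<and> deriv eta x \<le> 0)"

end

theory Submission
  imports Defs
begin

text \<open>By monotonicity and boundedness the front has a limit \<open>(U, E)\<close> at minus infinity, which is an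
  equilibrium with \<open>0 < U < lam\<close>. Equilibrium forces \<open>lam - U < 1\<close>, and this makes \<open>(U, E)\<close>
  unstable: the sum of the two equations shows that a positive combination \<open>S\<close> of \<open>u\<close> and
  \<open>eta\<close> is convex as long as \<open>U - u \<le> 1 - (lam - U)\<close>. A bounded nonincreasing function which is
  convex on a left half-line is constant there. So \<open>u = U\<close> on the whole region
  \<open>U - u \<le> 1 - (lam - U)\<close>, whereas by continuity \<open>u\<close> takes in it values below \<open>U\<close>.\<close>

section \<open>Bounded functions near minus infinity\<close>

lemma antimono_bounded_tendsto_at_bot:
  fixes f :: "real \<Rightarrow> real"
  assumes "antimono f" and "\<And>x. f x \<le> B"
  obtains L where "(f \<longlongrightarrow> L) at_bot" and "\<And>x. f x \<le> L"
proof
  have bdd: "bdd_above (range f)"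
    using assms(2) by (auto simp: bdd_above_def)
  show le: "f x \<le> (SUP y. f y)" for x
    using bdd by (simp add: cSUP_upper)
  show "(f \<longlongrightarrow> (SUP y. f y)) at_bot"
  proof (rule order_tendstoI)
    fix a assume "a < (SUP y. f y)"
    then obtain y where "a < f y"
      using bdd by (auto simp: less_cSUP_iff)
    then have "a < f x" if "x \<le> y" for x
      using antimonoD[OF assms(1) that] by simp
    then show "\<forall>\<^sub>F x in at_bot. a < f x"
      by (auto simp: eventually_at_bot_linorder)
  next
    fix a assume "(SUP y. f y) < a"
    then show "\<forall>\<^sub>F x in at_bot. f x < a"
      by (intro always_eventually allI le_less_trans[OF le])
  qed
qed

text \<open>Mean value theorem: over a long enough interval to the left of \<open>X\<close>, slope
  at least \<open>e\<close> forces an increase that the bound forbids.\<close>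

lemma bounded_not_deriv_ge_at_bot:
  fixes h h' :: "real \<Rightarrow> real"
  assumes der: "\<And>x. (h has_real_derivative h' x) (at x)"
    and bdd: "\<And>x. \<bar>h x\<bar> \<le> B" and "e > 0" and ge: "\<And>x. x \<le> X \<Longrightarrow> e \<le> h' x"
  shows False
proof -
  \<comment> \<open>This length makes \<open>h\<close> rise by at least \<open>2 * B + 1\<close> up
    to \<open>X\<close>, while two values of \<open>h\<close> differ by at most
    \<open>2 * B\<close>.\<close>
  define y where "y = X - (2 * B + 1) / e"
  have "B \<ge> 0"
    using bdd[of 0] by linarith
  then have "y < X"
    using \<open>e > 0\<close> by (simp add: y_def)
  then obtain z where z: "z < X" "h X - h y = (X - y) * h' z"
    using MVT2[of y X h h'] der by blast
  have "2 * B + 1 = (X - y) * e"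
    using \<open>e > 0\<close> by (simp add: y_def)
  also have "\<dots> \<le> (X - y) * h' z"
    using ge[of z] z(1) \<open>y < X\<close> by (intro mult_left_mono) auto
  also have "\<dots> = h X - h y"
    using z(2) by simp
  also have "\<dots> \<le> 2 * B"
    using bdd[of X] bdd[of y] by linarith
  finally show False by simp
qed

lemma bounded_deriv_limit_at_bot_le_0:
  fixes h h' :: "real \<Rightarrow> real"
  assumes "\<And>x. (h has_real_derivative h' x) (at x)"
    and "\<And>x. \<bar>h x\<bar> \<le> B" and lim: "(h' \<longlongrightarrow> l) at_bot"
  shows "l \<le> 0"
proof (rule ccontr)
  assume "\<not> l \<le> 0"
  then have "\<forall>\<^sub>F x in at_bot. l / 2 < h' x"
    using lim by (intro order_tendstoD) auto
  then obtain X where "\<And>x. x \<le> X \<Longrightarrow> l / 2 < h' x"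
    by (auto simp: eventually_at_bot_linorder)
  then show False
    using bounded_not_deriv_ge_at_bot[OF assms(1,2), of "l / 2" X] \<open>\<not> l \<le> 0\<close> less_imp_le by auto
qed

text \<open>Apply the one-sided bound to \<open>h\<close> and to \<open>- h\<close>. This yields the
  equilibrium equations without any limit of the second derivatives taken separately.\<close>

lemma bounded_deriv_limit_at_bot_eq_0:
  fixes h h' :: "real \<Rightarrow> real"
  assumes "\<And>x. (h has_real_derivative h' x) (at x)"
    and "\<And>x. \<bar>h x\<bar> \<le> B" and "(h' \<longlongrightarrow> l) at_bot"
  shows "l = 0"
proof -
  have "l \<le> 0"
    using assms by (rule bounded_deriv_limit_at_bot_le_0)
  moreover have "- l \<le> 0"
    using bounded_deriv_limit_at_bot_le_0[of "\<lambda>x. - h x" "\<lambda>x. - h' x" B "- l"] assms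
    by (auto intro: DERIV_minus tendsto_minus)
  ultimately show ?thesis by simp
qed

text \<open>Convexity makes \<open>f'\<close> nondecreasing up to \<open>X\<close>, so a negative
  slope at \<open>x\<close> persists all the way to the left and \<open>f\<close> would be unbounded
  there.\<close>

lemma bounded_convex_antimono_deriv_eq_0:
  fixes f f' f'' :: "real \<Rightarrow> real"
  assumes f: "\<And>x. (f has_real_derivative f' x) (at x)"
    and f': "\<And>x. (f' has_real_derivative f'' x) (at x)"
    and bdd: "\<And>x. \<bar>f x\<bar> \<le> B" and le0: "\<And>x. f' x \<le> 0"
    and convex: "\<And>x. x \<le> X \<Longrightarrow> f'' x \<ge> 0" and "x \<le> X"
  shows "f' x = 0"
proof (rule ccontr)
  assume "f' x \<noteq> 0"
  then have "f' x < 0"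
    using le0[of x] by simp
  have mono: "f' y \<le> f' x" if "y \<le> x" for y
  proof (rule DERIV_nonneg_imp_nondecreasing[OF that])
    fix z assume "z \<le> x"
    then show "\<exists>d. (f' has_real_derivative d) (at z) \<and> d \<ge> 0"
      using f'[of z] convex[of z] \<open>x \<le> X\<close> by auto
  qed
  show False
  proof (rule bounded_not_deriv_ge_at_bot[where e = "- f' x" and X = x])
    show "((\<lambda>y. - f y) has_real_derivative - f' y) (at y)" for y
      using f by (rule DERIV_minus)
    show "\<bar>- f y\<bar> \<le> B" for y
      using bdd by simp
  qed (use \<open>f' x < 0\<close> mono in auto)
qed

section \<open>Pointwise bounds from the norms\<close>

lemma abs_le_norm_Bcontfun:
  fixes f :: "real \<Rightarrow> real"
  assumes "f \<in> bcontfun"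
  shows "\<bar>f x\<bar> \<le> norm (Bcontfun f)"
  using norm_bounded[of "Bcontfun f" x] assms by (simp add: Bcontfun_inverse)

lemma C2_boundedE:
  assumes "f \<in> C2_bounded"
  obtains B where "\<And>x. (f has_real_derivative deriv f x) (at x)"
    and "\<And>x. (deriv f has_real_derivative deriv (deriv f) x) (at x)"
    and "\<And>x. \<bar>f x\<bar> \<le> B" and "\<And>x. \<bar>deriv f x\<bar> \<le> B"
proof
  let ?B = "max (norm (Bcontfun f)) (norm (Bcontfun (deriv f)))"
  show "(f has_real_derivative deriv f x) (at x)"
    and "(deriv f has_real_derivative deriv (deriv f) x) (at x)" for x
    using assms by (auto simp: C2_bounded_def DERIV_deriv_iff_field_differentiable)
  show "\<bar>f x\<bar> \<le> ?B" and "\<bar>deriv f x\<bar> \<le> ?B" for x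
    using assms abs_le_norm_Bcontfun[of f x] abs_le_norm_Bcontfun[of "deriv f" x]
    by (auto simp: C2_bounded_def)
qed

lemma abs_lincomb_le:
  fixes a b x y :: real
  assumes "\<bar>x\<bar> \<le> A" and "\<bar>y\<bar> \<le> B"
  shows "\<bar>a * x + b * y\<bar> \<le> \<bar>a\<bar> * A + \<bar>b\<bar> * B"
proof -
  have "\<bar>a * x + b * y\<bar> \<le> \<bar>a\<bar> * \<bar>x\<bar> + \<bar>b\<bar> * \<bar>y\<bar>"
    by (metis abs_mult abs_triangle_ineq)
  also have "\<dots> \<le> \<bar>a\<bar> * A + \<bar>b\<bar> * B"
    using assms by (intro add_mono mult_left_mono) auto
  finally show ?thesis .
qed

section \<open>Nonexistence of monotone fronts\<close>

theorem lemma3p2: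
  fixes lam k s :: real and u :: "real \<Rightarrow> real"
  assumes "lam > 1" and "0 < k" and "k < lam"
    and "s \<in> Gamma1 lam k" and "u \<in> Gamma2 lam"
  shows "\<not> (\<exists>eta :: real \<Rightarrow> real. monotone_front_solution lam k u eta s)"
proof
  assume "\<exists>eta. monotone_front_solution lam k u eta s"
  then obtain eta where front: "monotone_front_solution lam k u eta s" ..
  define a b c where "a = k * s" and "b = lam * s" and "c = (1/3 - (2 * k + 1) * s) * lam"
  have "s > 0" and G1: "lam\<^sup>2 / 3 - ((2 * k + 1) * lam\<^sup>2 + k\<^sup>2) * s > 0"
    using assms(4) by (auto simp: Gamma1_def)
  then have "a > 0" "b > 0"
    using assms(1,2) by (auto simp: a_def b_def)
  \<comment> \<open>The quantity that \<open>Gamma1\<close> makes positive is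
    \<open>lam * c - k\<^sup>2 * s\<close>; this fixes the sign of \<open>c\<close>.\<close>
  have "lam * c = (lam\<^sup>2 / 3 - ((2 * k + 1) * lam\<^sup>2 + k\<^sup>2) * s) + k\<^sup>2 * s"
    by (simp add: c_def power2_eq_square algebra_simps)
  moreover have "k\<^sup>2 * s > 0"
    using \<open>s > 0\<close> assms(2) by simp
  ultimately have "lam * c > 0"
    using G1 by linarith
  then have "c > 0"
    using assms(1) by (simp add: zero_less_mult_iff)

  have "u \<in> C2_bounded" "eta \<in> C2_bounded" and sys: "solves_system lam k s u eta"
    and lim_top: "((\<lambda>x. (u x, eta x)) \<longlongrightarrow> (0, 0)) at_top"
    and pos: "\<And>x. u x > 0" "\<And>x. eta x > 0"
    and dec: "\<And>x. deriv u x \<le> 0" "\<And>x. deriv eta x \<le> 0"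
    using front by (auto simp: monotone_front_solution_def)
  obtain Bu where u': "\<And>x. (u has_real_derivative deriv u x) (at x)"
    and u'': "\<And>x. (deriv u has_real_derivative deriv (deriv u) x) (at x)"
    and bu: "\<And>x. \<bar>u x\<bar> \<le> Bu" "\<And>x. \<bar>deriv u x\<bar> \<le> Bu"
    using C2_boundedE[OF \<open>u \<in> C2_bounded\<close>] by blast
  obtain Be where e': "\<And>x. (eta has_real_derivative deriv eta x) (at x)"
    and e'': "\<And>x. (deriv eta has_real_derivative deriv (deriv eta) x) (at x)"
    and be: "\<And>x. \<bar>eta x\<bar> \<le> Be" "\<And>x. \<bar>deriv eta x\<bar> \<le> Be"
    using C2_boundedE[OF \<open>eta \<in> C2_bounded\<close>] by blast
  have "a * deriv (deriv u) x + b * deriv (deriv eta) x + u x - lam * eta x + eta x * u x = 0 \<and>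
      c * deriv (deriv u) x + a * deriv (deriv eta) x - lam * u x + eta x + 1/2 * (u x)\<^sup>2 = 0" for x
    using sys unfolding solves_system_def a_def b_def c_def by blast
  note sys' = conjunct1[OF this] conjunct2[OF this]
  have eq1: "a * deriv (deriv u) x + b * deriv (deriv eta) x = - (u x - lam * eta x + eta x * u x)" for x
    using sys'(1)[of x] by linarith
  have eq2: "c * deriv (deriv u) x + a * deriv (deriv eta) x
      = - (- lam * u x + eta x + 1/2 * (u x)\<^sup>2)" for x
    using sys'(2)[of x] by (simp add: algebra_simps)
  have lincomb': "((\<lambda>x. p * u x + q * eta x) has_real_derivative p * deriv u x + q * deriv eta x) (at x)"
    and lincomb'': "((\<lambda>x. p * deriv u x + q * deriv eta x) has_real_derivative
      p * deriv (deriv u) x + q * deriv (deriv eta) x) (at x)" for p q x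
    by (intro DERIV_add DERIV_cmult u' e' u'' e'')+

  have anti: "antimono u" "antimono eta"
    by (rule antimonoI, erule DERIV_nonpos_imp_nonincreasing, use u' e' dec in blast)+
  obtain U where U: "(u \<longlongrightarrow> U) at_bot" and u_le: "\<And>x. u x \<le> U"
    using antimono_bounded_tendsto_at_bot[OF anti(1)] abs_le_D1[OF bu(1)] by blast
  obtain E where E: "(eta \<longlongrightarrow> E) at_bot" and eta_le: "\<And>x. eta x \<le> E"
    using antimono_bounded_tendsto_at_bot[OF anti(2)] abs_le_D1[OF be(1)] by blast
  have "U > 0" "E > 0"
    using pos u_le eta_le by (meson less_le_trans)+
  \<comment> \<open>Going through the norm keeps the inequality \<open>U < lam\<close> strict in the
    limit.\<close>
  have "u x \<le> norm (Bcontfun u)" for x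
    using abs_le_norm_Bcontfun[of u x] assms(5) by (auto simp: Gamma2_def)
  then have "U \<le> norm (Bcontfun u)"
    using U by (intro tendsto_upperbound[OF U]) auto
  then have "U < lam"
    using assms(5) by (auto simp: Gamma2_def)

  \<comment> \<open>By the first equation, the bounded function
    \<open>a * deriv u x + b * deriv eta x\<close> has a derivative converging to the left-hand
    side.\<close>
  have "- (U - lam * E + E * U) = 0"
  proof (rule bounded_deriv_limit_at_bot_eq_0)
    show "((\<lambda>x. a * deriv u x + b * deriv eta x) has_real_derivative
        - (u x - lam * eta x + eta x * u x)) (at x)" for x
      using lincomb''[of a b x] by (simp only: eq1)
    show "\<bar>a * deriv u x + b * deriv eta x\<bar> \<le> \<bar>a\<bar> * Bu + \<bar>b\<bar> * Be" for x
      using bu(2) be(2) by (rule abs_lincomb_le)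
    show "((\<lambda>x. - (u x - lam * eta x + eta x * u x)) \<longlongrightarrow> - (U - lam * E + E * U)) at_bot"
      by (intro tendsto_intros U E)
  qed
  then have equil1: "U = E * (lam - U)"
    by (simp add: algebra_simps)
  have "- (- lam * U + E + 1/2 * U\<^sup>2) = 0"
  proof (rule bounded_deriv_limit_at_bot_eq_0)
    show "((\<lambda>x. c * deriv u x + a * deriv eta x) has_real_derivative
        - (- lam * u x + eta x + 1/2 * (u x)\<^sup>2)) (at x)" for x
      using lincomb''[of c a x] by (simp only: eq2)
    show "\<bar>c * deriv u x + a * deriv eta x\<bar> \<le> \<bar>c\<bar> * Bu + \<bar>a\<bar> * Be" for x
      using bu(2) be(2) by (rule abs_lincomb_le)
    show "((\<lambda>x. - (- lam * u x + eta x + 1/2 * (u x)\<^sup>2)) \<longlongrightarrow>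
        - (- lam * U + E + 1/2 * U\<^sup>2)) at_bot"
      by (intro tendsto_intros U E)
  qed
  then have equil2: "E = U * (lam - U / 2)"
    by (simp add: algebra_simps power2_eq_square)

  define v where "v = lam - U"
  \<comment> \<open>Eliminating \<open>E\<close> from the two equilibrium equations and dividing by
    \<open>U\<close> gives \<open>(v + U / 2) * v = 1\<close>, which fails for
    \<open>v \<ge> 1\<close>.\<close>
  have "v < 1"
  proof (rule ccontr)
    assume "\<not> v < 1"
    then have "1 * 1 < (v + U / 2) * v"
      using \<open>U > 0\<close> by (intro mult_less_le_imp_less) auto
    moreover have "U * ((v + U / 2) * v) = U * 1"
      using equil1 unfolding equil2 by (simp add: v_def algebra_simps)
    ultimately show False
      using \<open>U > 0\<close> by simp
  qed

  \<comment> \<open>The first entry ensures \<open>U - u x \<le> 1 - v\<close> wherever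
    \<open>u x \<ge> t\<close>; the second keeps \<open>t\<close> positive, so that
    \<open>u\<close>, which tends to 0, reaches the level \<open>t\<close>.\<close>
  define t where "t = max (U - (1 - v)) (U / 2)"
  have "t < U" "t > 0"
    using \<open>v < 1\<close> \<open>U > 0\<close> by (auto simp: t_def)
  have "\<forall>\<^sub>F x in at_bot. t < u x"
    using U \<open>t < U\<close> by (rule order_tendstoD)
  then obtain y where y: "t < u y"
    by (auto simp: eventually_at_bot_linorder)
  have "(u \<longlongrightarrow> 0) at_top"
    using tendsto_fst[OF lim_top] by simp
  then have "\<forall>\<^sub>F x in at_top. u x < t"
    using \<open>t > 0\<close> by (rule order_tendstoD)
  then obtain z where z: "u z < t"
    by (auto simp: eventually_at_top_linorder)
  have "y \<le> z"
    using antimonoD[OF anti(1), of z y] y z by linarith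
  moreover have "isCont u x" for x
    using u' by (rule DERIV_isCont)
  ultimately obtain X where X: "u X = t"
    using IVT2[of u z t y] y z by auto

  have convex: "(a + c) * deriv (deriv u) x + (b + a) * deriv (deriv eta) x \<ge> 0" if "x \<le> X" for x
  proof -
    define w z where "w = U - u x" and "z = E - eta x"
    have "w \<ge> 0" "z \<ge> 0"
      using u_le eta_le by (auto simp: w_def z_def)
    have "w \<le> 1 - v"
      using antimonoD[OF anti(1) that] X by (auto simp: w_def t_def)
    have "(a + c) * deriv (deriv u) x + (b + a) * deriv (deriv eta) x
        = (a * deriv (deriv u) x + b * deriv (deriv eta) x)
          + (c * deriv (deriv u) x + a * deriv (deriv eta) x)"
      by (simp add: algebra_simps)
    also have "\<dots> = - (u x - lam * eta x + eta x * u x) - (- lam * u x + eta x + 1/2 * (u x)\<^sup>2)"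
      unfolding eq1 eq2 by simp
    \<comment> \<open>Expansion about the equilibrium: the two constant terms vanish by
      \<open>equil1\<close> and \<open>equil2\<close>, and both factors in brackets are nonnegative
      for \<open>0 \<le> w \<le> 1 - v\<close>.\<close>
    also have "\<dots> = w * (1 + E - v - w / 2) + z * (1 - v - w)
        - (U - E * (lam - U)) + (U * (lam - U / 2) - E)"
      by (simp add: w_def z_def v_def field_simps power2_eq_square)
    also have "\<dots> = w * (1 + E - v - w / 2) + z * (1 - v - w)"
      using equil1 equil2 by simp
    also have "\<dots> \<ge> 0"
      using \<open>w \<ge> 0\<close> \<open>z \<ge> 0\<close> \<open>w \<le> 1 - v\<close> \<open>E > 0\<close> by (intro add_nonneg_nonneg mult_nonneg_nonneg) auto
    finally show ?thesis .
  qed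
  have u'_eq_0: "deriv u x = 0" if "x \<le> X" for x
  proof -
    \<comment> \<open>Two nonpositive terms whose sum is zero both vanish, so constancy of the
      combination passes to \<open>u\<close> itself.\<close>
    have terms: "(a + c) * deriv u x \<le> 0" "(b + a) * deriv eta x \<le> 0" for x
      using \<open>a > 0\<close> \<open>b > 0\<close> \<open>c > 0\<close> dec by (auto intro!: mult_nonneg_nonpos)
    have "(a + c) * deriv u x + (b + a) * deriv eta x = 0"
    proof (rule bounded_convex_antimono_deriv_eq_0[OF lincomb' lincomb''])
      show "\<bar>(a + c) * u x + (b + a) * eta x\<bar> \<le> \<bar>a + c\<bar> * Bu + \<bar>b + a\<bar> * Be" for x
        using bu(1) be(1) by (rule abs_lincomb_le)
      show "(a + c) * deriv u x + (b + a) * deriv eta x \<le> 0" for x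
        using terms by (rule add_nonpos_nonpos)
    qed (use convex that in auto)
    then have "(a + c) * deriv u x = 0"
      using terms[of x] by linarith
    then show ?thesis
      using \<open>a > 0\<close> \<open>c > 0\<close> by simp
  qed
  \<comment> \<open>\<open>y\<close> was chosen with \<open>u y > t\<close>, hence lies to the left
    of \<open>X\<close>, where \<open>u\<close> is now constant.\<close>
  have "u y = t"
  proof -
    have "y < X"
      using antimonoD[OF anti(1), of X y] y X by (meson not_le less_irrefl less_le_trans)
    then show ?thesis
      using MVT2[of y X u "deriv u"] u' u'_eq_0 X by fastforce
  qed
  with y show False by simp
qed

end
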